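(* Let $\lambda\in\mathbb{C}$ with $\lambda\neq 1$, let $r,k\in\mathbb{Z}$ and $n\in\mathbb{Z}$ with $n\geq 2$. Then \[ (n+1)T_{n}^{(r,k)}(x|\lambda)+n\left(r-\tfrac{1}{2}-x\right)T_{n-1}^{(r,k)}(x|\lambda)+\sum_{l=0}^{n-2}\binom{n}{l}B_{n-l} T_{l}^{(r,k)}(x|\lambda) =-\frac{r\lambda n}{1-\lambda}T_{n-1}^{(r+1,k)}(x|\lambda)+\sum_{l=0}^{n}\binom{n}{l}B_{n-l} T_{l}^{(r,k-1)}(x|\lambda). \]
   Context: For $k\in\mathbb{Z}$, $Li_k(x)=\sum_{n\ge1}x^n/n^k$. For $r,k\in\mathbb{Z}$ the polynomials $T_n^{(r,k)}(x|\lambda)$ are defined by $\left(\frac{1-\lambda}{e^t-\lambda}\right)^r\frac{Li_{k}(1-e^{-t})}{1-e^{-t}}e^{xt}=\sum_{n\ge0}T_n^{(r,k)}(x|\lambda)\frac{t^n}{n!}$ (as formal power series in $t$). $B_l$ denotes the ordinary Bernoulli numbers, $\frac{t}{e^t-1}=\sum_{l\ge0}B_l\frac{t^l}{l!}$. *)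

theory Defs
  imports "HOL-Computational_Algebra.Computational_Algebra" Complex_Main
begin

definition Li :: "int \<Rightarrow> complex fps" where
  "Li k = Abs_fps (\<lambda>n. if n = 0 then 0 else 1 / of_nat n powi k)"

definition bernoulli_number :: "nat \<Rightarrow> complex" where
  "bernoulli_number l = fact l * fps_nth (fps_X / (fps_exp 1 - 1)) l"

(* Numerator and denominator of the middle factor both have subdegree 1, so the quotient is
   exact. The base of the power has constant term 1 when lam \<noteq> 1, so it is
   a unit and its negative powers are genuine inverses. *)
definition T_egf :: "int \<Rightarrow> int \<Rightarrow> complex \<Rightarrow> complex \<Rightarrow> complex fps" where
  "T_egf r k x lam =
     (fps_const (1 - lam) / (fps_exp 1 - fps_const lam)) powi r
     * ((Li k oo (1 - fps_exp (- 1))) / (1 - fps_exp (- 1)))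
     * fps_exp x"

definition T :: "nat \<Rightarrow> int \<Rightarrow> int \<Rightarrow> complex \<Rightarrow> complex \<Rightarrow> complex" where
  "T n r k x lam = fact n * fps_nth (T_egf r k x lam) n"

end

theory Submission
  imports Defs
begin

text \<open>With \<open>L\<^sub>k = Li\<^sub>k(1 - e\<^sup>-\<^sup>t) / (1 - e\<^sup>-\<^sup>t)\<close>, the relation \<open>x Li\<^sub>k'(x) = Li\<^sub>k\<^sub>-\<^sub>1(x)\<close> becomes
  \<open>L\<^sub>k + (e\<^sup>t - 1) L\<^sub>k' = L\<^sub>k\<^sub>-\<^sub>1\<close>, while \<open>w = (1 - \<lambda>) / (e\<^sup>t - \<lambda>)\<close> satisfies the Riccati equation
  \<open>w' = - w (1 + \<lambda> w / (1 - \<lambda>))\<close>. Differentiating the generating function \<open>w\<^sup>r L\<^sub>k e\<^sup>x\<^sup>t\<close> and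
  multiplying by \<open>t\<close>, where \<open>t / (e\<^sup>t - 1)\<close> absorbs the factor \<open>e\<^sup>t - 1\<close>, gives the identity on
  comparing coefficients and splitting off the terms with \<open>B\<^sub>0 = 1\<close> and \<open>B\<^sub>1 = - 1 / 2\<close>.\<close>

text \<open>Power series form no field, but a nonzero constant term makes \<open>w\<close> a unit,
  so \<open>inverse w * w = 1\<close> carries the exponent law to negative \<open>r\<close>.\<close>

lemma fps_power_int_add_1:
  fixes w :: "'a :: field fps"
  assumes "fps_nth w 0 \<noteq> 0"
  shows "w powi (r + 1) = w powi r * w"
proof (cases "r \<ge> 0")
  case True
  then show ?thesis by (simp add: power_int_def nat_add_distrib)
next
  case False
  have inv: "inverse w * w = 1" using assms by (rule inverse_mult_eq_1)
  have "nat (- r) = Suc (nat (- (r + 1)))" using False by linarith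
  then have "w powi r * w = inverse w ^ nat (- (r + 1)) * (inverse w * w)"
    using False by (simp add: power_int_def mult_ac)
  also have "\<dots> = w powi (r + 1)"
  proof (cases "r = -1")
    case True
    then show ?thesis using inv by simp
  next
    case False
    then show ?thesis using \<open>\<not> r \<ge> 0\<close> inv by (simp add: power_int_def)
  qed
  finally show ?thesis by simp
qed

text \<open>The power rule multiplied by \<open>w\<close>, which avoids the exponent
  \<open>r - 1\<close>. The product rule gives both induction directions; the downward one cancels a
  factor \<open>w\<close>.\<close>

lemma fps_deriv_power_int:
  fixes w :: "'a :: field fps"
  assumes w0: "fps_nth w 0 \<noteq> 0"
  shows "w * fps_deriv (w powi r) = of_int r * w powi r * fps_deriv w"
proof -
  have "w \<noteq> 0" using w0 by auto
  note step = fps_power_int_add_1[OF w0]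
  show ?thesis
  proof (induction r rule: int_induct[where k = 0])
    case base
    then show ?case by simp
  next
    case (step1 i)
    have "w * fps_deriv (w powi (i + 1)) = w * (w * fps_deriv (w powi i)) + w * (w powi i * fps_deriv w)"
      unfolding step by (simp add: algebra_simps)
    then show ?case unfolding step1 step by (simp add: algebra_simps)
  next
    case (step2 i)
    have s: "w powi i = w powi (i - 1) * w" using step[of "i - 1"] by simp
    have "w * (w * fps_deriv (w powi (i - 1)))
        = w * fps_deriv (w powi i) - w * (w powi (i - 1) * fps_deriv w)"
      by (simp add: s algebra_simps)
    also have "\<dots> = w * (of_int (i - 1) * w powi (i - 1) * fps_deriv w)"
      unfolding step2 by (simp add: s algebra_simps)
    finally show ?case using \<open>w \<noteq> 0\<close> by simp
  qed
qed

lemma fps_X_mult_deriv_Li: "fps_X * fps_deriv (Li k) = Li (k - 1)"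
proof (rule fps_ext)
  fix n
  show "fps_nth (fps_X * fps_deriv (Li k)) n = fps_nth (Li (k - 1)) n"
    by (cases n) (auto simp: Li_def power_int_diff simp del: of_nat_Suc)
qed

text \<open>The product \<open>u * ((Li k oo u) / u)\<close> is differentiated twice: by the product
  rule, and, since it equals \<open>Li k oo u\<close>, by the chain rule.\<close>

lemma Li_compose_deriv:
  fixes u :: "complex fps"
  assumes u0: "fps_nth u 0 = 0" and u: "u \<noteq> 0"
  shows "fps_deriv u * ((Li k oo u) / u) + u * fps_deriv ((Li k oo u) / u)
    = ((Li (k - 1) oo u) / u) * fps_deriv u"
proof -
  have L: "u * ((Li j oo u) / u) = Li j oo u" for j
  proof -
    \<comment> \<open>The division by \<open>u\<close> is exact: \<open>Li j\<close> is
      \<open>fps_X\<close> times a series, and composition turns \<open>fps_X\<close> into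
      \<open>u\<close>.\<close>
    have "u dvd (fps_X * fps_deriv (Li (j + 1))) oo u"
      unfolding fps_compose_mult_distrib[OF u0] by (simp add: fps_X_fps_compose_startby0[OF u0])
    then show ?thesis by (simp add: fps_X_mult_deriv_Li)
  qed
  have "u * (fps_deriv (Li k) oo u) = Li (k - 1) oo u"
    unfolding fps_X_mult_deriv_Li[symmetric] fps_compose_mult_distrib[OF u0]
    by (simp add: fps_X_fps_compose_startby0[OF u0])
  then have D: "fps_deriv (Li k) oo u = (Li (k - 1) oo u) / u"
    using u L[of "k - 1"] by (metis mult_left_cancel)
  have "fps_deriv (u * ((Li k oo u) / u)) = (fps_deriv (Li k) oo u) * fps_deriv u"
    unfolding L by (rule fps_compose_deriv[OF u0])
  then show ?thesis unfolding D by (simp add: algebra_simps)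
qed

definition bernoulli_egf :: "complex fps" where
  "bernoulli_egf = fps_X / (fps_exp 1 - 1)"

lemma bernoulli_egf_mult: "bernoulli_egf * (fps_exp 1 - 1) = fps_X"
proof -
  have s: "subdegree (fps_exp 1 - 1 :: complex fps) = 1"
    by (rule subdegreeI) auto
  then have "(fps_exp 1 - 1 :: complex fps) dvd fps_X"
    by (subst fps_dvd_iff) auto
  then show ?thesis unfolding bernoulli_egf_def by simp
qed

lemma bernoulli_number_0: "bernoulli_number 0 = 1"
  and bernoulli_number_1: "bernoulli_number (Suc 0) = - 1 / 2"
proof -
  have "fps_nth (bernoulli_egf * (fps_exp 1 - 1)) 1 = 1"
    unfolding bernoulli_egf_mult by simp
  then have b0: "fps_nth bernoulli_egf 0 = 1" by (simp add: fps_mult_nth)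
  \<comment> \<open>With b0, b1 the first coefficients of \<open>bernoulli_egf\<close>, this reads
    b1 + b0 / 2 = 0.\<close>
  have "fps_nth (bernoulli_egf * (fps_exp 1 - 1)) 2 = 0"
    unfolding bernoulli_egf_mult by simp
  then have "fps_nth bernoulli_egf (Suc 0) = - 1 / 2"
    by (simp add: fps_mult_nth numeral_2_eq_2 b0 eq_neg_iff_add_eq_0 add.commute)
  with b0 show "bernoulli_number 0 = 1" "bernoulli_number (Suc 0) = - 1 / 2"
    by (simp_all add: bernoulli_number_def bernoulli_egf_def)
qed

lemma T_egf_differential_equation:
  fixes lam x :: complex
  assumes lam: "lam \<noteq> 1"
  shows "fps_X * fps_deriv (T_egf r k x lam) =
      fps_const (x - of_int r) * (fps_X * T_egf r k x lam)
    - fps_const (of_int r * lam / (1 - lam)) * (fps_X * T_egf (r + 1) k x lam)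
    + bernoulli_egf * (T_egf r (k - 1) x lam - T_egf r k x lam)"
proof -
  define e :: "complex fps" where "e = fps_exp 1"
  define u :: "complex fps" where "u = 1 - fps_exp (- 1)"
  define w where "w = fps_const (1 - lam) / (e - fps_const lam)"
  define L where "L = (\<lambda>j. (Li j oo u) / u)"
  \<comment> \<open>Chosen so that \<open>c * w * (e - fps_const lam)\<close> is the constant
    \<open>lam\<close>; this eliminates \<open>e\<close> from the derivative of
    \<open>w\<close>.\<close>
  define c where "c = fps_const (lam / (1 - lam))"
  have T: "T_egf s j x lam = w powi s * L j * fps_exp x" for s j
    by (simp add: T_egf_def w_def L_def u_def e_def)

  have en: "fps_nth (e - fps_const lam) 0 \<noteq> 0" using lam by (simp add: e_def)
  then have nz: "e - fps_const lam \<noteq> 0" by auto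
  have w: "w * (e - fps_const lam) = fps_const (1 - lam)"
    unfolding w_def using en by (simp add: fps_divide_unit inverse_mult_eq_1 mult.assoc)
  have w0: "fps_nth w 0 \<noteq> 0"
    using arg_cong[OF w, of "\<lambda>f. fps_nth f 0"] lam by auto
  have c: "c * fps_const (1 - lam) = fps_const lam"
    using lam by (simp add: c_def)
  have "fps_deriv (w * (e - fps_const lam)) = 0" unfolding w by simp
  then have "fps_deriv w * (e - fps_const lam) = - (w * e)"
    by (simp add: e_def eq_neg_iff_add_eq_0 add.commute)
  moreover have "(- (w * (1 + c * w))) * (e - fps_const lam) = - (w * e)"
  proof -
    have "(- (w * (1 + c * w))) * (e - fps_const lam)
      = - (w * (e - fps_const lam)) - w * (c * (w * (e - fps_const lam)))"
      by (simp add: algebra_simps)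
    also have "\<dots> = - (w * (e - fps_const lam)) - w * fps_const lam"
      unfolding w c ..
    finally show ?thesis by (simp add: algebra_simps)
  qed
  ultimately have dw: "fps_deriv w = - (w * (1 + c * w))"
    using nz by (metis mult_right_cancel)
  have "w * fps_deriv (w powi r) = w * (- (of_int r * w powi r * (1 + c * w)))"
    unfolding fps_deriv_power_int[OF w0] dw by (simp add: algebra_simps)
  then have dW: "fps_deriv (w powi r) = - (of_int r * w powi r * (1 + c * w))"
    using w0 by (metis fps_zero_nth mult_left_cancel)

  have u0: "fps_nth u 0 = 0" by (simp add: u_def)
  have du: "fps_deriv u = fps_exp (- 1)" by (simp add: u_def flip: fps_const_neg)
  then have "u \<noteq> 0" by auto
  have ee: "e * fps_exp (- 1) = 1"
    unfolding e_def by (simp flip: fps_exp_add_mult)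
  then have eu: "e * u = e - 1" by (simp add: u_def algebra_simps)
  \<comment> \<open>Multiplying by \<open>e\<close> clears \<open>fps_exp (- 1)\<close> and turns
    \<open>u\<close> into \<open>e - 1\<close>, the factor that \<open>bernoulli_egf\<close>
    absorbs.\<close>
  have "(e * fps_exp (- 1)) * L k + (e * u) * fps_deriv (L k) = (e * fps_exp (- 1)) * L (k - 1)"
    using arg_cong[OF Li_compose_deriv[OF u0 \<open>u \<noteq> 0\<close>, of k], of "\<lambda>f. e * f"]
    by (simp add: L_def du algebra_simps)
  then have "(e - 1) * fps_deriv (L k) = L (k - 1) - L k"
    unfolding ee eu by (simp add: algebra_simps)
  then have dL: "fps_X * fps_deriv (L k) = bernoulli_egf * (L (k - 1) - L k)"
    unfolding bernoulli_egf_mult[symmetric] by (simp add: e_def mult.assoc)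

  have "fps_X * fps_deriv (T_egf r k x lam)
    = fps_X * (fps_deriv (w powi r) * L k * fps_exp x)
      + w powi r * fps_exp x * (fps_X * fps_deriv (L k))
      + fps_const x * (fps_X * T_egf r k x lam)"
    by (simp add: T algebra_simps)
  \<comment> \<open>The quadratic term of the Riccati equation raises the exponent of
    \<open>w\<close>, hence the index \<open>r + 1\<close>.\<close>
  also have "fps_X * (fps_deriv (w powi r) * L k * fps_exp x)
    = - (of_int r * (fps_X * T_egf r k x lam)) - of_int r * c * (fps_X * T_egf (r + 1) k x lam)"
    unfolding T dW fps_power_int_add_1[OF w0] by (simp add: algebra_simps)
  also have "of_int r * c = fps_const (of_int r * lam / (1 - lam))"
    by (simp add: c_def fps_of_int[symmetric])
  also have "(of_int r :: complex fps) = fps_const (of_int r)"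
    by (simp add: fps_of_int)
  finally show ?thesis
    unfolding dL by (simp add: T algebra_simps flip: fps_const_sub)
qed

lemma fact_mult_bernoulli_egf_mult_nth:
  "fact n * fps_nth (bernoulli_egf * f) n
    = (\<Sum>l=0..n. of_nat (n choose l) * bernoulli_number (n - l) * (fact l * fps_nth f l))"
  unfolding mult.commute[of bernoulli_egf] fps_mult_nth sum_distrib_left
  by (rule sum.cong)
     (auto simp: bernoulli_number_def bernoulli_egf_def binomial_fact field_simps)

theorem theorem4:
  fixes lam x :: complex and r k :: int and n :: nat
  assumes "lam \<noteq> 1" and "n \<ge> 2"
  shows "of_nat (n + 1) * T n r k x lam
           + of_nat n * (of_int r - 1 / 2 - x) * T (n - 1) r k x lam
           + (\<Sum>l=0..n - 2. of_nat (n choose l) * bernoulli_number (n - l) * T l r k x lam)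
         = - (of_int r * lam * of_nat n / (1 - lam)) * T (n - 1) (r + 1) k x lam
           + (\<Sum>l=0..n. of_nat (n choose l) * bernoulli_number (n - l) * T l r (k - 1) x lam)"
proof -
  obtain m where n: "n = Suc (Suc m)" using \<open>n \<ge> 2\<close> by (metis add_2_eq_Suc le_Suc_ex)
  let ?S = "\<lambda>j. \<Sum>l=0..n. of_nat (n choose l) * bernoulli_number (n - l) * T l r j x lam"
  have S: "fact n * fps_nth (bernoulli_egf * T_egf r j x lam) n = ?S j" for j
    by (simp add: fact_mult_bernoulli_egf_mult_nth T_def)
  have X: "fact n * fps_nth (fps_X * T_egf s k x lam) n = of_nat n * T (n - 1) s k x lam" for s
    by (simp add: n T_def)
  have D: "fact n * fps_nth (fps_X * fps_deriv (T_egf r k x lam)) n = of_nat n * T n r k x lam"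
    by (simp add: n T_def)
  have main: "of_nat n * T n r k x lam =
      (x - of_int r) * (of_nat n * T (n - 1) r k x lam)
    - of_int r * lam / (1 - lam) * (of_nat n * T (n - 1) (r + 1) k x lam) + (?S (k - 1) - ?S k)"
    unfolding D[symmetric] X[symmetric] S[symmetric] T_egf_differential_equation[OF \<open>lam \<noteq> 1\<close>]
      fps_add_nth fps_sub_nth fps_mult_left_const_nth
    by (simp add: algebra_simps del: fps_X_mult_nth)
  \<comment> \<open>The summands \<open>l = n - 1\<close> and \<open>l = n\<close> account for the
    \<open>- 1 / 2\<close> and for the step from \<open>n\<close> to \<open>n + 1\<close> in the
    coefficients of the theorem.\<close>
  have split: "?S k = (\<Sum>l=0..n - 2. of_nat (n choose l) * bernoulli_number (n - l) * T l r k x lam)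
      - of_nat n / 2 * T (n - 1) r k x lam + T n r k x lam"
    by (simp add: n bernoulli_number_0 bernoulli_number_1)
  show ?thesis using main unfolding split by (simp add: algebra_simps)
qed

end
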